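(* Let $(X,X')$ be an exchangeable pair of integer-valued random variables with $\mathbb{E}X=\mu$ and $\operatorname{Var}X=\sigma^2$ (finite, $\sigma^2>0$), such that $X'-X\in\{-1,0,1\}$ almost surely, and such that for some $\lambda>0$ $$\mathbb{E}[X'-\mu\mid X]=(1-\lambda)(X-\mu).$$ Then, with $S=S(X)=\mathbb{E}\{\mathrm{I}[X'\neq X]\mid X\}$, $$d_{\mathrm{TV}}\bigl(\mathscr{L}(X),\widehat{\mathrm{Bi}}(\mu,\sigma^2)\bigr)\leq\frac{\sqrt{\operatorname{Var}S}}{2\lambda\sigma^2}+\frac{1.4}{\sigma^2}.$$
   Context: A pair $(X,X')$ is exchangeable if $\mathbb{P}[X=x_1,X'=x_2]=\mathbb{P}[X=x_2,X'=x_1]$ for all $x_1,x_2$. $\mathrm{I}[\cdot]$ is the indicator of an event, and $\mathscr{L}(X)$ is the law of $X$. For probability measures $P,Q$ on $\mathbb{Z}$, $d_{\mathrm{TV}}(P,Q)=\sup_{A\subset\mathbb{Z}}|P[A]-Q[A]|$. For real $x$, $\lfloor x\rfloor$ and $\lceil x\rceil$ are the floor and ceiling, and $\langle x\rangle=x-\lfloor x\rfloor$. Given $\mu\in\mathbb{R}$ and $\sigma^2>0$, let $\delta=\langle-4\sigma^2\rangle$ (so $\lceil4\sigma^2\rceil=4\sigma^2+\delta$) and $t=\langle-\mu+2\sigma^2+\delta/2\rangle/\lceil4\sigma^2\rceil$. The translated (almost) symmetric binomial distribution $\widehat{\mathrm{Bi}}(\mu,\sigma^2)$ is the binomial distribution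 $\mathrm{Bi}(\lceil4\sigma^2\rceil,\tfrac12-t)$ shifted by $\mu-\lceil4\sigma^2\rceil(\tfrac12-t)$, i.e. the law of $Y+\mu-\lceil4\sigma^2\rceil(\tfrac12-t)$ with $Y\sim\mathrm{Bi}(\lceil4\sigma^2\rceil,\tfrac12-t)$ (number of trials, success probability). The shift is an integer. The statement is understood whenever this is a genuine probability distribution, i.e. $\tfrac12-t\ge0$ (automatic if $\sigma^2>1/4$). *)

theory Defs
  imports "HOL-Probability.Probability"
begin

definition exchangeable_pair :: "'a measure \<Rightarrow> ('a \<Rightarrow> int) \<Rightarrow> ('a \<Rightarrow> int) \<Rightarrow> bool" where
  "exchangeable_pair M X X' \<longleftrightarrow>
     (\<forall>x1 x2. measure M {\<omega> \<in> space M. X \<omega> = x1 \<and> X' \<omega> = x2}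
            = measure M {\<omega> \<in> space M. X \<omega> = x2 \<and> X' \<omega> = x1})"

text \<open>Conditional expectation of \<open>Y\<close> given \<open>X\<close>: it is taken with respect to the \<open>\<sigma>\<close>-algebra
  generated by \<open>X\<close>. As always, it is determined only up to null sets.\<close>

definition cond_exp_given :: "'a measure \<Rightarrow> ('a \<Rightarrow> int) \<Rightarrow> ('a \<Rightarrow> real) \<Rightarrow> 'a \<Rightarrow> real" where
  "cond_exp_given M X Y =
     real_cond_exp M (vimage_algebra (space M) X (count_space UNIV)) Y"

definition d_TV :: "int measure \<Rightarrow> int measure \<Rightarrow> real" where
  "d_TV P Q = (SUP A. \<bar>measure P A - measure Q A\<bar>)"

text \<open>The translated (almost) symmetric binomial distribution with parameters \<open>\<mu>\<close> and
  \<open>\<sigma>2\<close> (the latter plays the role of the variance, not of the standard deviation).\<close>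

definition tsb_delta :: "real \<Rightarrow> real" where
  "tsb_delta \<sigma>2 = frac (- 4 * \<sigma>2)"

definition tsb_t :: "real \<Rightarrow> real \<Rightarrow> real" where
  "tsb_t \<mu> \<sigma>2 = frac (- \<mu> + 2 * \<sigma>2 + tsb_delta \<sigma>2 / 2) / of_int \<lceil>4 * \<sigma>2\<rceil>"

definition tsb_shift :: "real \<Rightarrow> real \<Rightarrow> real" where
  "tsb_shift \<mu> \<sigma>2 = \<mu> - of_int \<lceil>4 * \<sigma>2\<rceil> * (1/2 - tsb_t \<mu> \<sigma>2)"

text \<open>The floor below only converts the shift to type \<^typ>\<open>int\<close>: the shift is an integer.\<close>

lemma tsb_shift_integer:
  assumes "\<sigma>2 > 0"
  shows "of_int \<lfloor>tsb_shift \<mu> \<sigma>2\<rfloor> = tsb_shift \<mu> \<sigma>2"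
proof -
  have n: "real_of_int \<lceil>4 * \<sigma>2\<rceil> = 4 * \<sigma>2 + tsb_delta \<sigma>2"
    by (simp add: tsb_delta_def frac_def ceiling_def)
  have "real_of_int \<lceil>4 * \<sigma>2\<rceil> \<noteq> 0"
    using assms by linarith
  then have "tsb_shift \<mu> \<sigma>2
      = \<mu> - of_int \<lceil>4 * \<sigma>2\<rceil> / 2 + frac (- \<mu> + 2 * \<sigma>2 + tsb_delta \<sigma>2 / 2)"
    unfolding tsb_shift_def tsb_t_def right_diff_distrib by simp
  also have "\<dots> = of_int (- \<lfloor>- \<mu> + 2 * \<sigma>2 + tsb_delta \<sigma>2 / 2\<rfloor>)"
    unfolding n frac_def by (simp add: field_simps)
  finally show ?thesis
    by (metis floor_of_int)
qed

text \<open>A genuine probability distribution of this kind requires \<^term>\<open>1/2 - tsb_t \<mu> \<sigma>2 \<ge> 0\<close>; outside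
  the range \<open>[0, 1]\<close> of the success probability, \<^const>\<open>binomial_pmf\<close> is unspecified.\<close>

definition tsb_pmf :: "real \<Rightarrow> real \<Rightarrow> int pmf" where
  "tsb_pmf \<mu> \<sigma>2 =
     map_pmf (\<lambda>k. int k + \<lfloor>tsb_shift \<mu> \<sigma>2\<rfloor>)
       (binomial_pmf (nat \<lceil>4 * \<sigma>2\<rceil>) (1/2 - tsb_t \<mu> \<sigma>2))"

end

theory Submission
  imports Defs
begin

text \<open>
  Put \<open>n = \<lceil>4 \<sigma>2\<rceil>\<close>, \<open>p = 1/2 - t\<close>, \<open>q = 1/2 + t\<close>, and let \<open>W\<close> be \<open>X\<close> without the integer shift, so
  that \<open>E W = n p\<close>. With \<open>\<Delta>g(k) = g(k + 1) - g(k)\<close>, the Stein operator of \<open>Bi(n, p)\<close> has the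
  symmetrised form
  \<open>p (n - k) g(k + 1) - q k g(k)
    = n p q \<Delta>g(k) - (k - n p) (g(k) + g(k + 1)) / 2 + t (k - n p) \<Delta>g(k)\<close>,
  and exchangeability gives \<open>lam E (W - n p) (g(W) + g(W + 1)) = E S \<Delta>g(W)\<close>; in particular
  \<open>E S = 2 lam \<sigma>2\<close>. For the solution \<open>g\<close> of the Stein equation of an event, extended by 0 outside
  \<open>{1..n}\<close>, Ehm's bound \<open>\<bar>\<Delta>g\<bar> \<le> 1 / ((n + 1) p q) \<le> 1 / \<sigma>2\<close> leaves the three errors
  \<open>\<bar>n p q - \<sigma>2\<bar>\<close>, \<open>sqrt (Var S) / (2 lam)\<close> and \<open>t \<sigma>\<close>, each divided by \<open>\<sigma>2\<close>, while the equation fails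
  only on \<open>W \<notin> {0..n}\<close>, which Chebyshev's inequality controls by \<open>1 / (4 \<sigma>2)\<close>. For \<open>\<sigma>2 \<le> 1.4\<close>
  the claim is trivial since \<open>d_TV \<le> 1\<close>.\<close>

section \<open>The Stein equation of the binomial distribution and the increments of its
  solution\<close>

locale binomial_stein =
  fixes n :: nat and p :: real
  assumes p_pos: "0 < p" and p_less: "p < 1"
begin

definition b :: "nat \<Rightarrow> real" where
  "b i = pmf (binomial_pmf n p) i"

lemma b_eq: "b i = real (n choose i) * p ^ i * (1 - p) ^ (n - i)"
  using p_pos p_less by (simp add: b_def)

lemma b_nonneg: "0 \<le> b i"
  by (simp add: b_def)

lemma b_pos: "i \<le> n \<Longrightarrow> 0 < b i"
  using p_pos p_less by (simp add: b_eq)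

lemma b_eq_0: "n < i \<Longrightarrow> b i = 0"
  by (simp add: b_eq)

text \<open>Detailed balance of the birth-death chain with birth rate \<open>p * (n - i)\<close> and
  death rate \<open>(1 - p) * i\<close>. The Stein equation and both tail comparisons rest on it.
  For \<open>i \<ge> n\<close> both sides vanish.\<close>

lemma b_Suc: "(1 - p) * real (Suc i) * b (Suc i) = p * (real n - real i) * b i"
proof (cases "i < n")
  case True
  have c: "real (Suc i) * real (n choose Suc i) = (real n - real i) * real (n choose i)"
    using binomial_absorb_comp[of n i] binomial_absorption[of i n] True
    by (metis (no_types, lifting) binomial_absorption less_imp_le_nat of_nat_diff of_nat_mult)
  have e: "n - i = Suc (n - Suc i)"
    using True by simp
  have "(1 - p) * real (Suc i) * b (Suc i)
      = (real (Suc i) * real (n choose Suc i)) * p ^ Suc i * ((1 - p) * (1 - p) ^ (n - Suc i))"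
    by (simp add: b_eq)
  also have "\<dots> = p * (real n - real i) * b i"
    unfolding c b_eq e by (simp del: of_nat_Suc)
  finally show ?thesis .
next
  case False
  then show ?thesis
    by (cases "i = n") (simp_all add: b_eq_0)
qed

lemma sum_b: "sum b {..n} = 1"
  using binomial_ring[of p "1 - p" n] by (simp add: b_eq[abs_def])

definition mean :: "(nat \<Rightarrow> real) \<Rightarrow> real" where
  "mean f = (\<Sum>i\<le>n. f i * b i)"

text \<open>The partial-sum solution of the Stein recursion. Division by zero supplies the boundary
  values: \<open>k = 0\<close> annihilates the denominator, and so does \<open>b k = 0\<close>
  beyond \<open>n\<close>.\<close>

definition g :: "(nat \<Rightarrow> real) \<Rightarrow> nat \<Rightarrow> real" where
  "g f k = ((\<Sum>i<k. f i * b i) - mean f * sum b {..<k}) / ((1 - p) * real k * b k)"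

lemma g_0: "g f 0 = 0"
  by (simp add: g_def)

lemma g_eq_0: "n < k \<Longrightarrow> g f k = 0"
  by (simp add: g_def b_eq_0)

text \<open>After multiplication by \<open>b k\<close>, detailed balance turns the two terms into
  consecutive numerators of \<open>g\<close>, whose difference is
  \<open>(f k - mean f) * b k\<close>. Beyond \<open>n\<close> both values of \<open>g\<close> are
  0.\<close>

lemma stein_eq:
  "p * (real n - real k) * g f (Suc k) - (1 - p) * real k * g f k
     = (if k \<le> n then f k - mean f else 0)"
proof (cases "k \<le> n")
  case True
  let ?N = "\<lambda>k. (\<Sum>i<k. f i * b i) - mean f * sum b {..<k}"
  have 1: "b k * (p * (real n - real k) * g f (Suc k)) = ?N (Suc k)"
  proof (cases "k = n")
    \<comment> \<open>The factor \<open>n - k\<close> is 0, and the numerator at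
      \<open>Suc n\<close> is \<open>mean f - mean f * 1\<close>.\<close>
    case True
    then show ?thesis
      using sum_b by (simp add: mean_def lessThan_Suc_atMost del: sum.lessThan_Suc)
  next
    case False
    then have "(1 - p) * real (Suc k) * b (Suc k) \<noteq> 0"
      using True b_pos[of "Suc k"] p_less by simp
    moreover have "b k * (p * (real n - real k) * g f (Suc k))
        = ((1 - p) * real (Suc k) * b (Suc k)) * g f (Suc k)"
      unfolding b_Suc by simp
    ultimately show ?thesis
      unfolding g_def by (simp del: of_nat_Suc sum.lessThan_Suc)
  qed
  have 2: "b k * ((1 - p) * real k * g f k) = ?N k"
    using b_pos[OF True] p_less by (cases "k = 0") (auto simp: g_def)
  have "b k * (p * (real n - real k) * g f (Suc k) - (1 - p) * real k * g f k)
      = b k * (f k - mean f)"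
    unfolding right_diff_distrib[of "b k" "p * _ * _"] 1 2 by (simp add: algebra_simps)
  then show ?thesis
    using b_pos[OF True] True by simp
qed (simp add: g_eq_0)

text \<open>Below \<open>k\<close> birth rates are at least the one at \<open>k\<close>;
  \<open>b_Suc\<close> moves the weight from \<open>i\<close> to \<open>Suc i\<close>, where death
  rates are at most the one at \<open>k\<close>. This settles the influence of the values of
  \<open>f\<close> above \<open>k\<close> in \<open>g_diff_le\<close>.\<close>

lemma head_le: "k \<le> n \<Longrightarrow> p * (real n - real k) * sum b {..<k} \<le> (1 - p) * real k * sum b {..k}"
proof -
  have "p * (real n - real k) * sum b {..<k} = (\<Sum>i<k. p * (real n - real k) * b i)"
    by (simp add: sum_distrib_left)
  also have "\<dots> \<le> (\<Sum>i<k. p * (real n - real i) * b i)"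
    using p_pos by (intro sum_mono mult_right_mono mult_left_mono) (auto simp: b_nonneg)
  also have "\<dots> = (\<Sum>i<k. (1 - p) * real (Suc i) * b (Suc i))"
    unfolding b_Suc ..
  also have "\<dots> \<le> (\<Sum>i<k. (1 - p) * real k * b (Suc i))"
    using p_less by (intro sum_mono mult_right_mono mult_left_mono) (auto simp: b_nonneg)
  also have "\<dots> = (1 - p) * real k * (\<Sum>i<k. b (Suc i))"
    by (simp add: sum_distrib_left)
  also have "(\<Sum>i<k. b (Suc i)) \<le> sum b {..k}"
    by (metis add.commute le_add_same_cancel2 b_nonneg sum.lessThan_Suc_shift lessThan_Suc_atMost)
  finally show ?thesis
    using p_less by (simp add: mult_left_mono)
qed

text \<open>Mirror image of \<open>head_le\<close>, with weights moved down from above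
  \<open>k\<close>; it settles the influence of the values of \<open>f\<close> below
  \<open>k\<close>.\<close>

lemma tail_le: "k \<le> n \<Longrightarrow> (1 - p) * real k * sum b {k<..n} \<le> p * (real n - real k) * sum b {k..n}"
proof -
  assume k: "k \<le> n"
  have "(1 - p) * real k * sum b {k<..n} = (1 - p) * real k * (\<Sum>i\<in>{k..<n}. b (Suc i))"
    by (simp add: atLeastSucAtMost_greaterThanAtMost[symmetric] sum.shift_bounds_Suc_ivl
        atLeastLessThanSuc_atLeastAtMost[symmetric] del: sum.op_ivl_Suc)
  also have "\<dots> = (\<Sum>i\<in>{k..<n}. (1 - p) * real k * b (Suc i))"
    by (simp add: sum_distrib_left)
  also have "\<dots> \<le> (\<Sum>i\<in>{k..<n}. (1 - p) * real (Suc i) * b (Suc i))"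
    using p_less by (intro sum_mono mult_right_mono mult_left_mono) (auto simp: b_nonneg)
  also have "\<dots> = (\<Sum>i\<in>{k..<n}. p * (real n - real i) * b i)"
    unfolding b_Suc ..
  also have "\<dots> \<le> (\<Sum>i\<in>{k..<n}. p * (real n - real k) * b i)"
    using p_pos by (intro sum_mono mult_right_mono mult_left_mono) (auto simp: b_nonneg)
  also have "\<dots> = p * (real n - real k) * sum b {k..<n}"
    by (simp add: sum_distrib_left)
  also have "\<dots> \<le> p * (real n - real k) * sum b {k..n}"
    using p_pos k by (intro mult_left_mono sum_mono2) (auto simp: b_nonneg)
  finally show ?thesis .
qed

text \<open>Comparison with \<open>Bi(n + 1, p)\<close>, whose weights \<open>\<rho>\<close> satisfy
  \<open>(n + 1) (1 - p) b i = (n + 1 - i) \<rho> i\<close> and \<open>(n + 1) p b i = (i + 1) \<rho> (i + 1)\<close>.\<close>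

lemma stein_factor_le:
  assumes k: "k \<le> n"
  shows "sum b {k<..n} / (p * (real n - real k)) + sum b {..<k} / ((1 - p) * real k)
    \<le> 1 / ((real n + 1) * p * (1 - p))"
proof -
  interpret r: binomial_stein "Suc n" p
    using p_pos p_less by unfold_locales
  have r1: "(real n + 1) * (1 - p) * b i = (real n + 1 - real i) * r.b i" if "i \<le> n" for i
  proof -
    have "real (Suc n - i) * real (Suc n choose i) = real (Suc n) * real (n choose i)"
      using binomial_absorb_comp[of "Suc n" i] by (metis diff_Suc_1 of_nat_mult)
    moreover have "real (Suc n - i) = real n + 1 - real i"
      using that by simp
    ultimately have "(real n + 1 - real i) * real (Suc n choose i) = (real n + 1) * real (n choose i)"
      by simp
    moreover have "(real n + 1 - real i) * r.b i
        = (real n + 1 - real i) * real (Suc n choose i) * (p ^ i * (1 - p) ^ Suc (n - i))"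
      using that by (simp only: r.b_eq Suc_diff_le mult.assoc)
    ultimately show ?thesis
      by (simp add: b_eq)
  qed
  have r2: "(real n + 1) * p * b i = (real i + 1) * r.b (Suc i)" for i
  proof -
    have "(real i + 1) * real (Suc n choose Suc i) = (real n + 1) * real (n choose i)"
      using Suc_times_binomial[of i n]
      by (metis of_nat_Suc of_nat_mult add.commute)
    then have "(real i + 1) * r.b (Suc i) = (real n + 1) * real (n choose i) * p ^ Suc i * (1 - p) ^ (n - i)"
      by (metis (no_types, lifting) r.b_eq diff_Suc_Suc mult.assoc)
    then show ?thesis
      by (simp add: b_eq algebra_simps)
  qed
  \<comment> \<open>At \<open>k = n\<close>, and in \<open>h\<close> at \<open>k = 0\<close>, the
    quotient is 0 / 0 = 0, in accordance with the empty sum.\<close>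
  have t: "(real n + 1) * (1 - p) * (sum b {k<..n} / (real n - real k)) \<le> sum r.b {k<..n}"
  proof (cases "k = n")
    case False
    then have pos: "0 < real n - real k" using k by simp
    have "(real n + 1) * (1 - p) * sum b {k<..n} = (\<Sum>i\<in>{k<..n}. (real n + 1 - real i) * r.b i)"
      unfolding sum_distrib_left by (intro sum.cong) (simp_all add: r1)
    also have "\<dots> \<le> (\<Sum>i\<in>{k<..n}. (real n - real k) * r.b i)"
      by (intro sum_mono mult_right_mono) (auto simp: r.b_nonneg)
    also have "\<dots> = (real n - real k) * sum r.b {k<..n}"
      by (simp add: sum_distrib_left)
    finally show ?thesis using pos by (simp add: field_simps)
  qed simp
  have h: "(real n + 1) * p * (sum b {..<k} / real k) \<le> (\<Sum>i<k. r.b (Suc i))"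
  proof (cases "k = 0")
    case False
    have "(real n + 1) * p * sum b {..<k} = (\<Sum>i<k. (real i + 1) * r.b (Suc i))"
      unfolding sum_distrib_left by (intro sum.cong) (simp_all add: r2)
    also have "\<dots> \<le> (\<Sum>i<k. real k * r.b (Suc i))"
      by (intro sum_mono mult_right_mono) (auto simp: r.b_nonneg)
    also have "\<dots> = real k * (\<Sum>i<k. r.b (Suc i))"
      by (simp add: sum_distrib_left)
    finally show ?thesis using False by (simp add: field_simps)
  qed simp
  \<comment> \<open>The shifted range \<open>{1..k}\<close> and \<open>{k<..n}\<close> are disjoint,
    so together they carry at most the total mass 1 of \<open>Bi(n + 1, p)\<close>.\<close>
  have "(\<Sum>i<k. r.b (Suc i)) + sum r.b {k<..n} = sum r.b (Suc ` {..<k} \<union> {k<..n})"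
    by (subst sum.union_disjoint) (auto simp: sum.reindex)
  also have "\<dots> \<le> sum r.b {..Suc n}"
    using k by (intro sum_mono2) (auto simp: r.b_nonneg)
  finally have s: "(\<Sum>i<k. r.b (Suc i)) + sum r.b {k<..n} \<le> 1"
    unfolding r.sum_b .
  have c: "0 < (real n + 1) * p * (1 - p)"
    using p_pos p_less by simp
  have "(real n + 1) * p * (1 - p) *
      (sum b {k<..n} / (p * (real n - real k)) + sum b {..<k} / ((1 - p) * real k))
      = (real n + 1) * (1 - p) * (sum b {k<..n} / (real n - real k))
        + (real n + 1) * p * (sum b {..<k} / real k)"
    using p_pos p_less by (simp add: distrib_left)
  also have "\<dots> \<le> 1"
    using t h s by linarith
  finally show ?thesis
    using c by (simp add: pos_le_divide_eq mult.commute)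
qed

text \<open>With \<open>f\<close> split at \<open>k\<close>, the increment is linear in
  \<open>al\<close>, \<open>f k\<close> and \<open>ga\<close>. By \<open>tail_le\<close> and
  \<open>head_le\<close> the contributions of \<open>al\<close> and \<open>ga\<close> are
  nonpositive, so the extreme case is the indicator of the point \<open>k\<close>, where the
  increment is the quantity bounded in \<open>stein_factor_le\<close>.\<close>

lemma g_diff_le:
  assumes f: "\<And>i. 0 \<le> f i" "\<And>i. f i \<le> 1"
  shows "g f (Suc k) - g f k \<le> 1 / ((real n + 1) * p * (1 - p))"
proof (cases "k \<le> n")
  case k: True
  define al ga T F where "al = (\<Sum>i<k. f i * b i)" and "ga = (\<Sum>i\<in>{k<..n}. f i * b i)"
    and "T = sum b {k<..n}" and "F = sum b {..<k}"
  define u v where "u = (1 - p) * real k" and "v = p * (real n - real k)"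
  have split: "sum h {..n} = sum h {..<k} + h k + sum h {k<..n}" for h :: "nat \<Rightarrow> real"
  proof -
    have "{..n} = insert k ({..<k} \<union> {k<..n})" using k by auto
    moreover have "sum h ({..<k} \<union> {k<..n}) = sum h {..<k} + sum h {k<..n}"
      by (intro sum.union_disjoint) auto
    ultimately show ?thesis by simp
  qed
  have tot: "F + b k + T = 1"
    using sum_b split[of b] by (simp add: F_def T_def)
  have m: "mean f = al + f k * b k + ga"
    unfolding mean_def split al_def ga_def by simp
  have bk: "0 < b k" using b_pos[OF k] .
  have nn: "0 \<le> al" "0 \<le> ga" "0 \<le> T" "0 \<le> F" "0 \<le> u" "0 \<le> v"
    unfolding al_def ga_def T_def F_def u_def v_def
    using f b_nonneg p_pos p_less k by (auto intro!: sum_nonneg mult_nonneg_nonneg)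
  have Fb: "sum b {..k} = F + b k"
    by (simp add: F_def lessThan_Suc_atMost[symmetric])
  have Tb: "sum b {k..n} = T + b k"
    using k by (simp add: T_def atLeastAtMost_insertL[OF k, symmetric] atLeastSucAtMost_greaterThanAtMost[symmetric])
  have H: "v * F \<le> u * (F + b k)"
    using head_le[OF k] unfolding Fb by (simp add: u_def v_def F_def)
  have L: "u * T \<le> v * (T + b k)"
    using tail_le[OF k] unfolding Tb by (simp add: u_def v_def T_def)
  have gS: "g f (Suc k) = (T * (al + f k * b k) - ga * (F + b k)) / (v * b k)"
  proof -
    have "al + f k * b k - mean f * (F + b k) = T * (al + f k * b k) - ga * (F + b k)"
      unfolding m using tot by algebra
    then show ?thesis
      unfolding g_def b_Suc by (simp add: v_def al_def F_def)
  qed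
  have gk: "g f k = (al * (T + b k) - F * (f k * b k + ga)) / (u * b k)"
  proof -
    have "al - mean f * F = al * (T + b k) - F * (f k * b k + ga)"
      unfolding m using tot by algebra
    then show ?thesis
      unfolding g_def by (simp add: u_def al_def F_def)
  qed
  \<comment> \<open>If \<open>k = 0\<close> then \<open>u = 0\<close>, but \<open>al\<close> is an
    empty sum; if \<open>k = n\<close> then \<open>v = 0\<close> and \<open>T / v\<close> is
    0.\<close>
  have A: "al * (T / v - (T + b k) / u) \<le> 0"
  proof (cases "k = 0")
    case False
    then have "0 < u" using p_less by (simp add: u_def)
    then have "T / v \<le> (T + b k) / u"
      using L nn bk by (cases "v = 0") (auto simp: field_simps)
    then show ?thesis using nn by (simp add: mult_nonneg_nonpos)
  qed (simp add: al_def)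
  have G: "ga * (F / u - (F + b k) / v) \<le> 0"
  proof (cases "k = n")
    case False
    then have "0 < v" using p_pos k by (simp add: v_def)
    then have "F / u \<le> (F + b k) / v"
      using H nn bk by (cases "u = 0") (auto simp: field_simps)
    then show ?thesis using nn by (simp add: mult_nonneg_nonpos)
  qed (simp add: ga_def)
  have "b k * inverse (b k) = 1"
    using bk by simp
  then have "g f (Suc k) - g f k
      = (al * (T / v - (T + b k) / u) + ga * (F / u - (F + b k) / v)) / b k + f k * (T / v + F / u)"
    unfolding gS gk divide_inverse inverse_mult_distrib by algebra
  also have "\<dots> \<le> 0 + 1 * (T / v + F / u)"
    using A G bk f(2)[of k] nn
    by (intro add_mono mult_right_mono divide_nonpos_pos add_nonpos_nonpos) auto
  also have "\<dots> \<le> 1 / ((real n + 1) * p * (1 - p))"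
    using stein_factor_le[OF k] by (simp add: T_def F_def u_def v_def)
  finally show ?thesis .
next
  case False
  then show ?thesis
    using p_pos p_less by (simp add: g_eq_0)
qed

text \<open>The solution is linear in \<open>f\<close> and vanishes for constant \<open>f\<close>.
  Complementation thus turns the upper bound on increments into a lower one.\<close>

lemma g_complement: "g (\<lambda>i. 1 - f i) k = - g f k"
proof -
  have "mean (\<lambda>i. 1 - f i) = 1 - mean f"
    using sum_b by (simp add: mean_def left_diff_distrib sum_subtractf)
  then have "(\<Sum>i<k. (1 - f i) * b i) - mean (\<lambda>i. 1 - f i) * sum b {..<k}
      = - ((\<Sum>i<k. f i * b i) - mean f * sum b {..<k})"
    by (simp add: left_diff_distrib sum_subtractf)
  then show ?thesis
    by (simp only: g_def minus_divide_left)
qed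

lemma abs_g_diff_le:
  assumes f: "\<And>i. 0 \<le> f i" "\<And>i. f i \<le> 1"
  shows "\<bar>g f (Suc k) - g f k\<bar> \<le> 1 / ((real n + 1) * p * (1 - p))"
  using g_diff_le[of f k] g_diff_le[of "\<lambda>i. 1 - f i" k] f by (simp add: g_complement abs_le_iff)

end

section \<open>Exchangeable pairs, linear regression and Stein's identity\<close>

lemma (in prob_space) exchangeable_integral:
  fixes X X' :: "'a \<Rightarrow> int" and \<phi> :: "int \<Rightarrow> int \<Rightarrow> real"
  assumes X [measurable]: "X \<in> measurable M (count_space UNIV)"
    and X' [measurable]: "X' \<in> measurable M (count_space UNIV)"
    and ex: "exchangeable_pair M X X'"
  shows "expectation (\<lambda>\<omega>. \<phi> (X \<omega>) (X' \<omega>)) = expectation (\<lambda>\<omega>. \<phi> (X' \<omega>) (X \<omega>))"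
proof -
  let ?N = "count_space UNIV :: (int \<times> int) measure"
  have [measurable]: "(\<lambda>\<omega>. (X \<omega>, X' \<omega>)) \<in> measurable M ?N"
      "(\<lambda>\<omega>. (X' \<omega>, X \<omega>)) \<in> measurable M ?N"
    using measurable_Pair[OF X X'] measurable_Pair[OF X' X]
    by (simp_all add: pair_measure_countable)
  \<comment> \<open>Exchangeability equates the point masses of the two ordered pairs, and these
    determine a law on a countable space.\<close>
  have "distr M ?N (\<lambda>\<omega>. (X \<omega>, X' \<omega>)) = distr M ?N (\<lambda>\<omega>. (X' \<omega>, X \<omega>))"
  proof (rule measure_eqI_countable[of _ UNIV])
    fix a :: "int \<times> int"
    have "(\<lambda>\<omega>. (X \<omega>, X' \<omega>)) -` {a} \<inter> space M = {\<omega> \<in> space M. X \<omega> = fst a \<and> X' \<omega> = snd a}"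
      "(\<lambda>\<omega>. (X' \<omega>, X \<omega>)) -` {a} \<inter> space M = {\<omega> \<in> space M. X \<omega> = snd a \<and> X' \<omega> = fst a}"
      by (auto simp: prod_eq_iff)
    then show "emeasure (distr M ?N (\<lambda>\<omega>. (X \<omega>, X' \<omega>))) {a}
        = emeasure (distr M ?N (\<lambda>\<omega>. (X' \<omega>, X \<omega>))) {a}"
      using ex by (simp add: emeasure_distr emeasure_eq_measure exchangeable_pair_def)
  qed auto
  then have "integral\<^sup>L (distr M ?N (\<lambda>\<omega>. (X \<omega>, X' \<omega>))) (case_prod \<phi>)
      = integral\<^sup>L (distr M ?N (\<lambda>\<omega>. (X' \<omega>, X \<omega>))) (case_prod \<phi>)"
    by simp
  then show ?thesis
    by (simp add: integral_distr)
qed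

locale stein_pair = prob_space M for M :: "'a measure" +
  fixes X X' :: "'a \<Rightarrow> int" and \<mu> lam :: real and S :: "'a \<Rightarrow> real"
  assumes X [measurable]: "X \<in> measurable M (count_space UNIV)"
    and X' [measurable]: "X' \<in> measurable M (count_space UNIV)"
    and exch: "exchangeable_pair M X X'"
    and int_X: "integrable M (\<lambda>\<omega>. real_of_int (X \<omega>))"
    and int_X2: "integrable M (\<lambda>\<omega>. (real_of_int (X \<omega>))\<^sup>2)"
    and mean_X: "expectation (\<lambda>\<omega>. real_of_int (X \<omega>)) = \<mu>"
    and step: "AE \<omega> in M. X' \<omega> - X \<omega> \<in> {-1, 0, 1}"
    and regression: "AE \<omega> in M. cond_exp_given M X (\<lambda>\<omega>. real_of_int (X' \<omega>) - \<mu>) \<omega>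
                      = (1 - lam) * (real_of_int (X \<omega>) - \<mu>)"
    and S_def: "S = cond_exp_given M X (indicator {\<omega> \<in> space M. X' \<omega> \<noteq> X \<omega>})"
begin

abbreviation "F \<equiv> vimage_algebra (space M) X (count_space UNIV)"

sublocale F: finite_measure_subalgebra M F
proof
  show "subalgebra M F"
    using X by (auto simp: subalgebra_def sets_vimage_algebra2 measurable_sets)
qed

lemma measurable_F: "(\<lambda>\<omega>. h (X \<omega>)) \<in> borel_measurable F" for h :: "int \<Rightarrow> real"
  by (rule measurable_compose[OF measurable_vimage_algebra1]) auto

abbreviation D :: "'a \<Rightarrow> real" where
  "D \<omega> \<equiv> real_of_int (X' \<omega>) - real_of_int (X \<omega>)"

lemma D_bound: "AE \<omega> in M. \<bar>D \<omega>\<bar> \<le> 1"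
  using step by eventually_elim auto

lemma integrable_D_mult:
  assumes "integrable M (\<lambda>\<omega>. h (X \<omega>))"
  shows "integrable M (\<lambda>\<omega>. h (X \<omega>) * D \<omega>)"
proof (rule Bochner_Integration.integrable_bound[OF assms])
  show "AE \<omega> in M. norm (h (X \<omega>) * D \<omega>) \<le> norm (h (X \<omega>))"
    using D_bound by eventually_elim (auto simp: abs_mult intro: mult_left_le)
qed simp

text \<open>The regression condition says that \<open>D\<close> has conditional expectation
  \<open>- lam * (X - \<mu>)\<close> given \<open>X\<close>; the factor
  \<open>h (X \<omega>)\<close> is measurable for \<open>F\<close> and can be pulled out.\<close>

lemma expectation_D_mult:
  assumes h: "integrable M (\<lambda>\<omega>. h (X \<omega>))"
    and Xh: "integrable M (\<lambda>\<omega>. (real_of_int (X \<omega>) - \<mu>) * h (X \<omega>))"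
  shows "expectation (\<lambda>\<omega>. h (X \<omega>) * D \<omega>)
    = - lam * expectation (\<lambda>\<omega>. (real_of_int (X \<omega>) - \<mu>) * h (X \<omega>))"
proof -
  let ?Y = "\<lambda>\<omega>. real_of_int (X' \<omega>) - \<mu>" and ?Z = "\<lambda>\<omega>. real_of_int (X \<omega>) - \<mu>"
  have eq: "h (X \<omega>) * ?Y \<omega> = h (X \<omega>) * D \<omega> + ?Z \<omega> * h (X \<omega>)" for \<omega>
    by (simp add: algebra_simps)
  have int: "integrable M (\<lambda>\<omega>. h (X \<omega>) * ?Y \<omega>)"
    unfolding eq using integrable_D_mult[OF h] Xh by simp
  have "expectation (\<lambda>\<omega>. h (X \<omega>) * ?Y \<omega>) = expectation (\<lambda>\<omega>. h (X \<omega>) * real_cond_exp M F ?Y \<omega>)"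
    using F.real_cond_exp_intg(2)[OF int measurable_F] by simp
  also have "\<dots> = expectation (\<lambda>\<omega>. (1 - lam) * (?Z \<omega> * h (X \<omega>)))"
  proof (rule integral_cong_AE)
    show "AE \<omega> in M. h (X \<omega>) * real_cond_exp M F ?Y \<omega> = (1 - lam) * (?Z \<omega> * h (X \<omega>))"
      using regression unfolding cond_exp_given_def by eventually_elim simp
  qed auto
  finally have "expectation (\<lambda>\<omega>. h (X \<omega>) * D \<omega>) + expectation (\<lambda>\<omega>. ?Z \<omega> * h (X \<omega>))
      = (1 - lam) * expectation (\<lambda>\<omega>. ?Z \<omega> * h (X \<omega>))"
    unfolding eq Bochner_Integration.integral_add[OF integrable_D_mult[OF h] Xh]
      integral_mult_right_zero .
  then show ?thesis
    by (simp only: left_diff_distrib mult_minus_left mult_1_left)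
qed

text \<open>\<open>S\<close> is a version of a conditional probability. Boundedness makes a product
  with \<open>S\<close> integrable whenever the other factor is.\<close>

lemma S_range: "AE \<omega> in M. 0 \<le> S \<omega> \<and> S \<omega> \<le> 1"
proof -
  let ?I = "indicator {\<omega> \<in> space M. X' \<omega> \<noteq> X \<omega>} :: 'a \<Rightarrow> real"
  have "integrable M ?I" by (simp add: integrable_indicator_iff emeasure_eq_measure)
  then have "AE \<omega> in M. 0 \<le> real_cond_exp M F ?I \<omega>" "AE \<omega> in M. real_cond_exp M F ?I \<omega> \<le> 1"
    by (intro F.real_cond_exp_ge_c F.real_cond_exp_le_c; simp add: indicator_def)+
  then show ?thesis
    unfolding S_def cond_exp_given_def by eventually_elim simp
qed

lemma S_measurable [measurable]: "S \<in> borel_measurable M"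
  unfolding S_def cond_exp_given_def by simp

lemma integrable_mult_S:
  fixes u :: "'a \<Rightarrow> real"
  assumes "integrable M u"
  shows "integrable M (\<lambda>\<omega>. u \<omega> * S \<omega>)"
proof (rule Bochner_Integration.integrable_bound[OF assms])
  show "AE \<omega> in M. norm (u \<omega> * S \<omega>) \<le> norm (u \<omega>)"
    using S_range by eventually_elim (auto simp: abs_mult intro: mult_left_le)
qed (use assms in measurable)

lemma expectation_mult_S:
  assumes h: "integrable M (\<lambda>\<omega>. h (X \<omega>))"
  shows "expectation (\<lambda>\<omega>. h (X \<omega>) * S \<omega>)
    = expectation (\<lambda>\<omega>. h (X \<omega>) * indicator {\<omega> \<in> space M. X' \<omega> \<noteq> X \<omega>} \<omega>)"
proof -
  have "integrable M (\<lambda>\<omega>. h (X \<omega>) * indicator {\<omega> \<in> space M. X' \<omega> \<noteq> X \<omega>} \<omega>)"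
    by (rule integrable_real_mult_indicator[OF _ h]) measurable
  then show ?thesis
    unfolding S_def cond_exp_given_def
    using F.real_cond_exp_intg(2)[OF _ measurable_F, of h] by simp
qed

text \<open>Antisymmetry turns the backward jumps in \<open>E (X' - X) h(X)\<close> into forward jumps, and the
  forward jump probability given \<open>X\<close> is half of \<open>S + E(X' - X | X)\<close>.\<close>

lemma stein_identity:
  assumes h: "integrable M (\<lambda>\<omega>. h (X \<omega>))" "integrable M (\<lambda>\<omega>. h (X \<omega> + 1))"
    and Xh: "integrable M (\<lambda>\<omega>. (real_of_int (X \<omega>) - \<mu>) * h (X \<omega>))"
      "integrable M (\<lambda>\<omega>. (real_of_int (X \<omega>) - \<mu>) * h (X \<omega> + 1))"
  shows "lam * expectation (\<lambda>\<omega>. (real_of_int (X \<omega>) - \<mu>) * (h (X \<omega>) + h (X \<omega> + 1)))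
    = expectation (\<lambda>\<omega>. (h (X \<omega> + 1) - h (X \<omega>)) * S \<omega>)"
proof -
  let ?u = "\<lambda>\<omega>. if X' \<omega> = X \<omega> + 1 then 1 else 0 :: real"
  let ?d = "\<lambda>\<omega>. if X \<omega> = X' \<omega> + 1 then 1 else 0 :: real"
  let ?\<Delta> = "\<lambda>x. h (x + 1) - h x"
  let ?I = "indicator {\<omega> \<in> space M. X' \<omega> \<noteq> X \<omega>} :: 'a \<Rightarrow> real"
  have hd: "integrable M (\<lambda>\<omega>. ?\<Delta> (X \<omega>))"
    using h by simp
  have Xd: "integrable M (\<lambda>\<omega>. (real_of_int (X \<omega>) - \<mu>) * ?\<Delta> (X \<omega>))"
    using Xh by (simp add: right_diff_distrib)
  have [simp]: "integrable M (\<lambda>\<omega>. h (X \<omega>) * ?u \<omega>)" "integrable M (\<lambda>\<omega>. h (X \<omega>) * ?d \<omega>)"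
    "integrable M (\<lambda>\<omega>. h (X \<omega> + 1) * ?u \<omega>)"
    by (rule Bochner_Integration.integrable_bound[OF h(1)], simp, simp,
        rule Bochner_Integration.integrable_bound[OF h(1)], simp, simp,
        rule Bochner_Integration.integrable_bound[OF h(2)], simp, simp)
  have I: "integrable M (\<lambda>\<omega>. ?\<Delta> (X \<omega>) * ?I \<omega>)"
    by (rule integrable_real_mult_indicator[OF _ hd]) measurable
  have "expectation (\<lambda>\<omega>. h (X \<omega>) * D \<omega>) = expectation (\<lambda>\<omega>. h (X \<omega>) * ?u \<omega> - h (X \<omega>) * ?d \<omega>)"
  proof (rule integral_cong_AE)
    show "AE \<omega> in M. h (X \<omega>) * D \<omega> = h (X \<omega>) * ?u \<omega> - h (X \<omega>) * ?d \<omega>"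
      using step by eventually_elim (auto simp: algebra_simps)
  qed auto
  also have "\<dots> = expectation (\<lambda>\<omega>. h (X \<omega>) * ?u \<omega>) - expectation (\<lambda>\<omega>. h (X \<omega>) * ?d \<omega>)"
    by simp
  also have "expectation (\<lambda>\<omega>. h (X \<omega>) * ?d \<omega>) = expectation (\<lambda>\<omega>. h (X \<omega> + 1) * ?u \<omega>)"
  proof -
    have "expectation (\<lambda>\<omega>. h (X \<omega>) * ?d \<omega>) = expectation (\<lambda>\<omega>. h (X' \<omega>) * ?u \<omega>)"
      by (rule exchangeable_integral[OF X X' exch])
    also have "\<dots> = expectation (\<lambda>\<omega>. h (X \<omega> + 1) * ?u \<omega>)"
      by (rule Bochner_Integration.integral_cong) auto
    finally show ?thesis .
  qed
  also have "expectation (\<lambda>\<omega>. h (X \<omega>) * ?u \<omega>) - expectation (\<lambda>\<omega>. h (X \<omega> + 1) * ?u \<omega>)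
      = expectation (\<lambda>\<omega>. h (X \<omega>) * ?u \<omega> - h (X \<omega> + 1) * ?u \<omega>)"
    by simp
  also have "\<dots> = expectation (\<lambda>\<omega>. - (?\<Delta> (X \<omega>) * ?I \<omega> + ?\<Delta> (X \<omega>) * D \<omega>) / 2)"
  proof (rule integral_cong_AE)
    show "AE \<omega> in M. h (X \<omega>) * ?u \<omega> - h (X \<omega> + 1) * ?u \<omega>
        = - (?\<Delta> (X \<omega>) * ?I \<omega> + ?\<Delta> (X \<omega>) * D \<omega>) / 2"
      using step AE_space
    proof eventually_elim
      case (elim \<omega>)
      then consider "X' \<omega> = X \<omega> + 1" | "X' \<omega> = X \<omega>" | "X \<omega> = X' \<omega> + 1"
        by auto
      then show ?case
        using elim(2) by cases (simp_all add: field_simps)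
    qed
  qed auto
  also have "\<dots> = - (expectation (\<lambda>\<omega>. ?\<Delta> (X \<omega>) * S \<omega>) + expectation (\<lambda>\<omega>. ?\<Delta> (X \<omega>) * D \<omega>)) / 2"
    unfolding expectation_mult_S[of ?\<Delta>, OF hd] using I integrable_D_mult[of ?\<Delta>, OF hd] by simp
  \<comment> \<open>\<open>expectation_D_mult\<close> applies to both terms on the left, and
    \<open>2 * h x + (h (x + 1) - h x)\<close> is the symmetric sum
    \<open>h x + h (x + 1)\<close>.\<close>
  finally have "2 * expectation (\<lambda>\<omega>. h (X \<omega>) * D \<omega>) + expectation (\<lambda>\<omega>. ?\<Delta> (X \<omega>) * D \<omega>)
      = - expectation (\<lambda>\<omega>. ?\<Delta> (X \<omega>) * S \<omega>)"
    by simp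
  moreover have "expectation (\<lambda>\<omega>. (real_of_int (X \<omega>) - \<mu>) * (h (X \<omega>) + h (X \<omega> + 1)))
      = 2 * expectation (\<lambda>\<omega>. (real_of_int (X \<omega>) - \<mu>) * h (X \<omega>))
        + expectation (\<lambda>\<omega>. (real_of_int (X \<omega>) - \<mu>) * ?\<Delta> (X \<omega>))"
    using Xh by (simp add: distrib_left right_diff_distrib)
  ultimately show ?thesis
    unfolding expectation_D_mult[OF h(1) Xh(1)] expectation_D_mult[of ?\<Delta>, OF hd Xd]
    by (simp add: algebra_simps)
qed

lemma integrable_square: "integrable M (\<lambda>\<omega>. (real_of_int (X \<omega>) - \<mu>)\<^sup>2)"
  using int_X int_X2 by (simp add: power2_diff)

text \<open>Stein's identity for \<open>h x = x\<close>, whose increment is 1. Of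
  \<open>(X - \<mu>) * (2 * X + 1)\<close> only twice the square of \<open>X - \<mu>\<close> has a
  nonzero mean in general.\<close>

lemma expectation_S: "expectation S = 2 * lam * variance (\<lambda>\<omega>. real_of_int (X \<omega>))"
proof -
  have i: "integrable M (\<lambda>\<omega>. (real_of_int (X \<omega>) - \<mu>) * real_of_int (X \<omega>))"
    using int_X int_X2 by (simp add: left_diff_distrib flip: power2_eq_square)
  moreover have "integrable M (\<lambda>\<omega>. (real_of_int (X \<omega>) - \<mu>) * real_of_int (X \<omega> + 1))"
    using i int_X by (simp add: distrib_left)
  ultimately have "lam * expectation (\<lambda>\<omega>. (real_of_int (X \<omega>) - \<mu>) *
      (real_of_int (X \<omega>) + real_of_int (X \<omega> + 1))) = expectation S"
    using stein_identity[of real_of_int] int_X by simp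
  moreover have "(\<lambda>\<omega>. (real_of_int (X \<omega>) - \<mu>) * (real_of_int (X \<omega>) + real_of_int (X \<omega> + 1)))
     = (\<lambda>\<omega>. 2 * (real_of_int (X \<omega>) - \<mu>)\<^sup>2 + (2 * \<mu> + 1) * (real_of_int (X \<omega>) - \<mu>))"
    by (simp add: fun_eq_iff power2_eq_square algebra_simps)
  ultimately show ?thesis
    using integrable_square int_X mean_X by (simp add: prob_space)
qed

end

section \<open>The expectation of the symmetrised Stein operator\<close>

lemma (in prob_space) abs_expectation_mult_le:
  fixes u w :: "'a \<Rightarrow> real"
  assumes u: "integrable M u" "integrable M (\<lambda>\<omega>. (u \<omega>)\<^sup>2)"
    and w [measurable]: "w \<in> borel_measurable M" and c: "\<And>\<omega>. \<bar>w \<omega>\<bar> \<le> c"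
  shows "\<bar>expectation (\<lambda>\<omega>. w \<omega> * u \<omega>)\<bar> \<le> c * sqrt (expectation (\<lambda>\<omega>. (u \<omega>)\<^sup>2))"
proof -
  have c0: "0 \<le> c"
    using c[of undefined] by linarith
  have wu: "\<bar>w \<omega> * u \<omega>\<bar> \<le> c * \<bar>u \<omega>\<bar>" for \<omega>
    unfolding abs_mult using c[of \<omega>] by (rule mult_right_mono) simp
  \<comment> \<open>Cauchy-Schwarz for \<open>\<bar>u\<bar>\<close> against 1, read off from a
    nonnegative variance.\<close>
  have "0 \<le> variance (\<lambda>\<omega>. \<bar>u \<omega>\<bar>)"
    by (rule variance_positive)
  also have "\<dots> = expectation (\<lambda>\<omega>. (u \<omega>)\<^sup>2) - (expectation (\<lambda>\<omega>. \<bar>u \<omega>\<bar>))\<^sup>2"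
    using u by (subst variance_eq) simp_all
  finally have *: "expectation (\<lambda>\<omega>. \<bar>u \<omega>\<bar>) \<le> sqrt (expectation (\<lambda>\<omega>. (u \<omega>)\<^sup>2))"
    by (intro real_le_rsqrt) simp
  have "\<bar>expectation (\<lambda>\<omega>. w \<omega> * u \<omega>)\<bar> \<le> expectation (\<lambda>\<omega>. \<bar>w \<omega> * u \<omega>\<bar>)"
    by (rule integral_abs_bound)
  also have "\<dots> \<le> expectation (\<lambda>\<omega>. c * \<bar>u \<omega>\<bar>)"
  proof (rule integral_mono)
    show "integrable M (\<lambda>\<omega>. \<bar>w \<omega> * u \<omega>\<bar>)"
      by (rule Bochner_Integration.integrable_bound[of M "\<lambda>\<omega>. c * \<bar>u \<omega>\<bar>"])
        (use u wu c0 in \<open>auto simp: abs_mult\<close>)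
  qed (use u wu in auto)
  also have "\<dots> \<le> c * sqrt (expectation (\<lambda>\<omega>. (u \<omega>)\<^sup>2))"
    using * c0 by (simp add: mult_left_mono)
  finally show ?thesis .
qed

context stein_pair
begin

text \<open>Stein's identity replaces the middle term by an increment weighted with
  \<open>S\<close>. The mean of \<open>S\<close> then nearly cancels \<open>v\<close>; what remains
  is the variance mismatch, the fluctuation of \<open>S\<close> and the skewness term with
  \<open>t\<close>. The bound \<open>C\<close> secures integrability.\<close>

lemma stein_operator_bound:
  fixes g :: "int \<Rightarrow> real" and v t C c :: real
  assumes lam: "0 < lam" and t: "0 \<le> t"
    and C: "\<And>k. \<bar>g k\<bar> \<le> C" and c: "\<And>k. \<bar>g (k + 1) - g k\<bar> \<le> c"
  defines "op \<equiv> \<lambda>x. v * (g (x + 1) - g x) - (real_of_int x - \<mu>) * (g x + g (x + 1)) / 2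
      + t * (real_of_int x - \<mu>) * (g (x + 1) - g x)"
    and "\<sigma>2 \<equiv> variance (\<lambda>\<omega>. real_of_int (X \<omega>))"
  shows "integrable M (\<lambda>\<omega>. op (X \<omega>))"
    and "\<bar>expectation (\<lambda>\<omega>. op (X \<omega>))\<bar>
      \<le> c * (\<bar>v - \<sigma>2\<bar> + sqrt (variance S) / (2 * lam) + t * sqrt \<sigma>2)"
proof -
  let ?\<Delta> = "\<lambda>\<omega>. g (X \<omega> + 1) - g (X \<omega>)" and ?Z = "\<lambda>\<omega>. real_of_int (X \<omega>) - \<mu>"
  have bd: "integrable M (\<lambda>\<omega>. g (X \<omega>))" "integrable M (\<lambda>\<omega>. g (X \<omega> + 1))"
    by (rule integrable_const_bound[of _ C]; simp add: C)+
  have Z: "integrable M ?Z"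
    using int_X by simp
  have Zg: "integrable M (\<lambda>\<omega>. ?Z \<omega> * g (X \<omega>))" "integrable M (\<lambda>\<omega>. ?Z \<omega> * g (X \<omega> + 1))"
    by (rule Bochner_Integration.integrable_bound[of M "\<lambda>\<omega>. C * ?Z \<omega>"];
        use Z C in \<open>auto simp: abs_mult mult.commute[of "\<bar>_ - \<mu>\<bar>"]
          intro!: mult_right_mono order_trans[OF C abs_ge_self]\<close>)+
  have \<Delta>: "integrable M ?\<Delta>" and Z\<Delta>: "integrable M (\<lambda>\<omega>. ?Z \<omega> * ?\<Delta> \<omega>)"
      and Zs: "integrable M (\<lambda>\<omega>. ?Z \<omega> * (g (X \<omega>) + g (X \<omega> + 1)))"
    using bd Zg by (simp_all add: right_diff_distrib distrib_left)
  have op: "op (X \<omega>) = v * ?\<Delta> \<omega> - ?Z \<omega> * (g (X \<omega>) + g (X \<omega> + 1)) / 2 + t * (?Z \<omega> * ?\<Delta> \<omega>)" for \<omega>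
    by (simp add: op_def)
  show "integrable M (\<lambda>\<omega>. op (X \<omega>))"
    unfolding op using \<Delta> Z\<Delta> Zs by simp
  have S: "integrable M S"
    using integrable_mult_S[of "\<lambda>_. 1"] by simp
  have S2: "integrable M (\<lambda>\<omega>. (S \<omega>)\<^sup>2)"
    using integrable_mult_S[OF S] by (simp add: power2_eq_square)
  have "expectation (\<lambda>\<omega>. op (X \<omega>)) = v * expectation ?\<Delta>
      - expectation (\<lambda>\<omega>. ?Z \<omega> * (g (X \<omega>) + g (X \<omega> + 1))) / 2 + t * expectation (\<lambda>\<omega>. ?Z \<omega> * ?\<Delta> \<omega>)"
    unfolding op using \<Delta> Z\<Delta> Zs by simp
  also have "expectation (\<lambda>\<omega>. ?Z \<omega> * (g (X \<omega>) + g (X \<omega> + 1))) = expectation (\<lambda>\<omega>. ?\<Delta> \<omega> * S \<omega>) / lam"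
    using stein_identity[OF bd Zg] lam by (simp add: field_simps)
  \<comment> \<open>\<open>S\<close> is split into its fluctuation and its mean, known from
    \<open>expectation_S\<close>.\<close>
  also have "expectation (\<lambda>\<omega>. ?\<Delta> \<omega> * S \<omega>)
      = expectation (\<lambda>\<omega>. ?\<Delta> \<omega> * (S \<omega> - expectation S)) + expectation ?\<Delta> * (2 * lam * \<sigma>2)"
  proof -
    have "expectation (\<lambda>\<omega>. ?\<Delta> \<omega> * (S \<omega> - expectation S))
        = expectation (\<lambda>\<omega>. ?\<Delta> \<omega> * S \<omega>) - expectation ?\<Delta> * expectation S"
      unfolding right_diff_distrib[of "?\<Delta> _"] using integrable_mult_S[OF \<Delta>] \<Delta> by simp
    then show ?thesis
      by (simp add: expectation_S \<sigma>2_def)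
  qed
  finally have E: "expectation (\<lambda>\<omega>. op (X \<omega>)) = (v - \<sigma>2) * expectation ?\<Delta>
      - expectation (\<lambda>\<omega>. ?\<Delta> \<omega> * (S \<omega> - expectation S)) / (2 * lam)
      + t * expectation (\<lambda>\<omega>. ?\<Delta> \<omega> * ?Z \<omega>)"
    using lam by (simp add: field_simps)
  have "\<bar>expectation (\<lambda>\<omega>. ?\<Delta> \<omega> * 1)\<bar> \<le> c * sqrt (expectation (\<lambda>\<omega>. 1\<^sup>2))"
    by (rule abs_expectation_mult_le) (simp_all add: c)
  then have "\<bar>expectation ?\<Delta>\<bar> \<le> c"
    by (simp add: prob_space)
  then have 1: "\<bar>(v - \<sigma>2) * expectation ?\<Delta>\<bar> \<le> \<bar>v - \<sigma>2\<bar> * c"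
    unfolding abs_mult by (rule mult_left_mono) simp
  have "\<bar>expectation (\<lambda>\<omega>. ?\<Delta> \<omega> * (S \<omega> - expectation S))\<bar> \<le> c * sqrt (variance S)"
    by (rule abs_expectation_mult_le) (use S S2 c in \<open>simp_all add: power2_diff\<close>)
  then have 2: "\<bar>expectation (\<lambda>\<omega>. ?\<Delta> \<omega> * (S \<omega> - expectation S)) / (2 * lam)\<bar>
      \<le> c * sqrt (variance S) / (2 * lam)"
    using lam by (simp add: divide_right_mono)
  have "\<bar>expectation (\<lambda>\<omega>. ?\<Delta> \<omega> * ?Z \<omega>)\<bar> \<le> c * sqrt \<sigma>2"
    unfolding \<sigma>2_def mean_X by (rule abs_expectation_mult_le) (use Z integrable_square c in simp_all)
  then have 3: "\<bar>t * expectation (\<lambda>\<omega>. ?\<Delta> \<omega> * ?Z \<omega>)\<bar> \<le> t * (c * sqrt \<sigma>2)"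
    using t by (simp add: abs_mult mult_left_mono)
  have "\<bar>expectation (\<lambda>\<omega>. op (X \<omega>))\<bar>
      \<le> \<bar>v - \<sigma>2\<bar> * c + c * sqrt (variance S) / (2 * lam) + t * (c * sqrt \<sigma>2)"
    unfolding E using 1 2 3 by linarith
  then show "\<bar>expectation (\<lambda>\<omega>. op (X \<omega>))\<bar>
      \<le> c * (\<bar>v - \<sigma>2\<bar> + sqrt (variance S) / (2 * lam) + t * sqrt \<sigma>2)"
    by (simp add: algebra_simps)
qed

end

section \<open>Parameters and weights of the translated binomial distribution\<close>

lemma tsb_parameter_bounds:
  fixes \<mu> \<sigma>2 :: real
  assumes large: "1.4 < \<sigma>2"
  defines "n \<equiv> real_of_int \<lceil>4 * \<sigma>2\<rceil>" and "t \<equiv> tsb_t \<mu> \<sigma>2"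
  shows "6 \<le> n" "4 * \<sigma>2 \<le> n" "0 \<le> t" "t < 1/2" "n * t < 1"
    and "\<bar>n * (1/4 - t\<^sup>2) - \<sigma>2\<bar> \<le> 1/4" "\<sigma>2 \<le> (n + 1) * (1/4 - t\<^sup>2)" "t * sqrt \<sigma>2 \<le> 1/4"
proof -
  \<comment> \<open>Here 4 * 1.4 = 5.6.\<close>
  have "5 < \<lceil>4 * \<sigma>2\<rceil>"
    using large by (simp add: less_ceiling_iff)
  then show n6: "6 \<le> n"
    by (simp add: n_def)
  show n4: "4 * \<sigma>2 \<le> n"
    by (simp add: n_def)
  have n5: "n < 4 * \<sigma>2 + 1"
    unfolding n_def by linarith
  show t0: "0 \<le> t"
    unfolding t_def tsb_t_def n_def[symmetric] using n6 by simp
  \<comment> \<open>\<open>t\<close> is a fractional part divided by \<open>n\<close>. With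
    \<open>n \<ge> 6\<close> this forces \<open>t < 1/6\<close>, and then \<open>n * t^2\<close> is
    at most 1/6.\<close>
  have "n * t = frac (- \<mu> + 2 * \<sigma>2 + tsb_delta \<sigma>2 / 2)"
    unfolding t_def tsb_t_def n_def[symmetric] using n6 by simp
  then show nt: "n * t < 1"
    by (simp add: frac_lt_1)
  have "6 * t \<le> n * t"
    using n6 t0 by (rule mult_right_mono)
  then have t6: "t < 1/6"
    using nt by simp
  then show "t < 1/2"
    by simp
  have "(n * t) * t \<le> 1 * t"
    using nt t0 by (intro mult_right_mono) auto
  then have nt2: "n * t\<^sup>2 \<le> 1/6"
    using t6 by (simp add: power2_eq_square)
  have nt20: "0 \<le> n * t\<^sup>2"
    using n6 by simp
  have "t * t \<le> (1/6) * (1/6)"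
    using t6 t0 by (intro mult_mono) auto
  then have t2: "t\<^sup>2 \<le> 1/36"
    by (simp add: power2_eq_square)
  \<comment> \<open>Rounding up puts \<open>n / 4 - \<sigma>2\<close> between 0 and 1/4, while
    \<open>n * t^2\<close> lies between 0 and 1/6.\<close>
  show "\<bar>n * (1/4 - t\<^sup>2) - \<sigma>2\<bar> \<le> 1/4"
    unfolding right_diff_distrib using nt2 nt20 n4 n5 by linarith
  \<comment> \<open>The additional 1/4 from \<open>n + 1\<close> in place of \<open>n\<close>
    absorbs \<open>n * t^2 + t^2\<close>, at most 1/6 + 1/36.\<close>
  show "\<sigma>2 \<le> (n + 1) * (1/4 - t\<^sup>2)"
    unfolding right_diff_distrib distrib_right using nt2 n4 t2 by linarith
  have "sqrt \<sigma>2 \<le> \<sigma>2"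
    using large by (intro real_le_lsqrt) (auto simp: power2_eq_square)
  then have "t * sqrt \<sigma>2 \<le> t * (n / 4)"
    using n4 t0 by (intro mult_left_mono) auto
  then show "t * sqrt \<sigma>2 \<le> 1/4"
    using nt by (simp add: mult.commute)
qed

text \<open>Undoes the shift and uses the finite support. The sum has the form of
  \<open>mean\<close> in \<open>binomial_stein\<close>, for the indicator of \<open>A\<close> moved
  back by the shift.\<close>

lemma measure_tsb_pmf:
  "measure (measure_pmf (tsb_pmf \<mu> \<sigma>2)) A
    = (\<Sum>i\<le>nat \<lceil>4 * \<sigma>2\<rceil>. indicator A (int i + \<lfloor>tsb_shift \<mu> \<sigma>2\<rfloor>)
        * pmf (binomial_pmf (nat \<lceil>4 * \<sigma>2\<rceil>) (1/2 - tsb_t \<mu> \<sigma>2)) i)"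
  if "0 \<le> 1/2 - tsb_t \<mu> \<sigma>2" "1/2 - tsb_t \<mu> \<sigma>2 \<le> 1"
proof -
  let ?B = "binomial_pmf (nat \<lceil>4 * \<sigma>2\<rceil>) (1/2 - tsb_t \<mu> \<sigma>2)"
  have "(\<lambda>i. indicator A (int i + \<lfloor>tsb_shift \<mu> \<sigma>2\<rfloor>) :: real)
      = indicator ((\<lambda>i. int i + \<lfloor>tsb_shift \<mu> \<sigma>2\<rfloor>) -` A)"
    by (auto simp: fun_eq_iff indicator_def)
  then have "measure (measure_pmf (tsb_pmf \<mu> \<sigma>2)) A
      = measure_pmf.expectation ?B (\<lambda>i. indicator A (int i + \<lfloor>tsb_shift \<mu> \<sigma>2\<rfloor>))"
    by (simp add: tsb_pmf_def)
  also have "\<dots> = (\<Sum>i\<le>nat \<lceil>4 * \<sigma>2\<rceil>. indicator A (int i + \<lfloor>tsb_shift \<mu> \<sigma>2\<rfloor>) * pmf ?B i)"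
    by (rule integral_measure_pmf_real)
      (use that set_pmf_binomial_eq[of "1/2 - tsb_t \<mu> \<sigma>2"] in \<open>auto split: if_splits\<close>)
  finally show ?thesis .
qed

lemma d_TV_le:
  assumes "\<And>A. \<bar>measure P A - measure Q A\<bar> \<le> e"
  shows "d_TV P Q \<le> e"
  unfolding d_TV_def using assms by (intro cSUP_least) auto

section \<open>Comparison of the law of \<open>X\<close> with the translated binomial
  distribution\<close>

theorem theorem1p5:
  fixes M :: "'a measure" and X X' :: "'a \<Rightarrow> int"
    and \<mu> \<sigma>2 lam :: real and S :: "'a \<Rightarrow> real"
  assumes "prob_space M"
    and "X \<in> measurable M (count_space UNIV)"
    and "X' \<in> measurable M (count_space UNIV)"
    and "exchangeable_pair M X X'"
    and "integrable M (\<lambda>\<omega>. real_of_int (X \<omega>))"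
    and "integrable M (\<lambda>\<omega>. (real_of_int (X \<omega>))\<^sup>2)"
    and "prob_space.expectation M (\<lambda>\<omega>. real_of_int (X \<omega>)) = \<mu>"
    and "prob_space.variance M (\<lambda>\<omega>. real_of_int (X \<omega>)) = \<sigma>2"
    and "\<sigma>2 > 0"
    and "AE \<omega> in M. X' \<omega> - X \<omega> \<in> {-1, 0, 1}"
    and "lam > 0"
    and "AE \<omega> in M. cond_exp_given M X (\<lambda>\<omega>. real_of_int (X' \<omega>) - \<mu>) \<omega>
                      = (1 - lam) * (real_of_int (X \<omega>) - \<mu>)"
    and "S = cond_exp_given M X (indicator {\<omega> \<in> space M. X' \<omega> \<noteq> X \<omega>})"
    and "1/2 - tsb_t \<mu> \<sigma>2 \<ge> 0"
  shows "d_TV (distr M (count_space UNIV) X) (measure_pmf (tsb_pmf \<mu> \<sigma>2))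
           \<le> sqrt (prob_space.variance M S) / (2 * lam * \<sigma>2) + 1.4 / \<sigma>2"
proof -
  interpret prob_space M by fact
  interpret E: stein_pair M X X' \<mu> lam S
    using assms by unfold_locales
  note [measurable] = E.X
  let ?P = "distr M (count_space UNIV) X" and ?Q = "measure_pmf (tsb_pmf \<mu> \<sigma>2)"
  have var0: "0 \<le> sqrt (variance S) / (2 * lam * \<sigma>2)"
    using assms(9,11) variance_positive[of S] by simp
  show ?thesis
  proof (cases "\<sigma>2 \<le> 1.4")
    case True
    interpret P: prob_space ?P
      by (rule prob_space_distr) simp
    have "\<bar>measure ?P A - measure ?Q A\<bar> \<le> 1" for A
      using P.prob_le_1[of A] measure_pmf.prob_le_1[of "tsb_pmf \<mu> \<sigma>2" A]
        measure_nonneg[of ?P A] measure_nonneg[of ?Q A] by linarith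
    then have "d_TV ?P ?Q \<le> 1"
      by (rule d_TV_le)
    also have "1 \<le> 1.4 / \<sigma>2"
      using True assms(9) by simp
    finally show ?thesis
      using var0 by linarith
  next
    case False
    define n where "n = nat \<lceil>4 * \<sigma>2\<rceil>"
    define t where "t = tsb_t \<mu> \<sigma>2"
    define s where "s = \<lfloor>tsb_shift \<mu> \<sigma>2\<rfloor>"
    have rn: "real_of_int \<lceil>4 * \<sigma>2\<rceil> = real n"
      unfolding n_def using assms(9) by simp
    have large: "1.4 < \<sigma>2" using False by simp
    note bounds = tsb_parameter_bounds(1,2)[OF large, unfolded rn]
      tsb_parameter_bounds(3-)[OF large, of \<mu>, folded t_def, unfolded rn]
    have rs: "real_of_int s = \<mu> - real n * (1/2 - t)"
      unfolding s_def tsb_shift_integer[OF assms(9)] by (simp add: tsb_shift_def rn t_def)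
    interpret B: binomial_stein n "1/2 - t"
      using bounds by unfold_locales auto
    have pq: "a * (1/2 - t) * (1 - (1/2 - t)) = a * (1/4 - t\<^sup>2)" for a
      by (simp add: power2_eq_square algebra_simps)
    \<comment> \<open>Chebyshev's inequality at distance \<open>n / 2\<close>, which is at least
      \<open>2 * \<sigma>2\<close>.\<close>
    have tail: "prob {\<omega> \<in> space M. real n / 2 \<le> \<bar>real_of_int (X \<omega>) - \<mu>\<bar>} \<le> 1/4 / \<sigma>2"
    proof -
      have "prob {\<omega> \<in> space M. real n / 2 \<le> \<bar>real_of_int (X \<omega>) - \<mu>\<bar>} \<le> \<sigma>2 / (real n / 2)\<^sup>2"
        using Chebyshev_inequality[of "\<lambda>\<omega>. real_of_int (X \<omega>)" "real n / 2"] bounds(1) assms(6,7,8)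
        by simp
      also have "\<dots> \<le> \<sigma>2 / (2 * \<sigma>2)\<^sup>2"
        using bounds(2) assms(9) by (intro divide_left_mono power_mono mult_pos_pos) auto
      also have "\<dots> = 1/4 / \<sigma>2"
        using assms(9) by (simp add: power2_eq_square)
      finally show ?thesis .
    qed
    show ?thesis
    proof (rule d_TV_le)
      fix A
      define f :: "nat \<Rightarrow> real" where "f = (\<lambda>i. indicator A (int i + s))"
      \<comment> \<open>\<open>nat\<close> sends all \<open>x \<le> s\<close> to 0, where
        \<open>B.g f\<close> vanishes, so this is the extension by 0 to all integers.\<close>
      define g where "g = (\<lambda>x. B.g f (nat (x - s)))"
      define op where "op = (\<lambda>x. real n * (1/4 - t\<^sup>2) * (g (x + 1) - g x)
        - (real_of_int x - \<mu>) * (g x + g (x + 1)) / 2 + t * (real_of_int x - \<mu>) * (g (x + 1) - g x))"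
      have Q: "measure ?Q A = B.mean f"
        unfolding B.mean_def B.b_def f_def
        using measure_tsb_pmf[of \<mu> \<sigma>2 A, folded n_def t_def s_def] bounds(3,4) by simp
      have op: "op x = (if 0 \<le> x - s \<and> x - s \<le> int n then indicator A x - measure ?Q A else 0)" for x
      proof (cases "0 \<le> x - s")
        case True
        then obtain k where k: "x - s = int k"
          using nonneg_int_cases by blast
        then have x: "x = int k + s" by simp
        have "real_of_int x - \<mu> = real k - real n * (1/2 - t)"
          by (simp add: x rs)
        moreover have "g x = B.g f k" "g (x + 1) = B.g f (Suc k)"
          by (simp_all add: g_def x nat_add_distrib)
        \<comment> \<open>The symmetrised form read backwards, with success probability
          \<open>1/2 - t\<close> and \<open>p * q = 1/4 - t^2\<close>.\<close>
        ultimately have "op x = (1/2 - t) * (real n - real k) * B.g f (Suc k)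
            - (1 - (1/2 - t)) * real k * B.g f k"
          by (simp only: op_def) (simp add: field_simps power2_eq_square)
        then show ?thesis
          unfolding B.stein_eq Q by (simp add: x f_def)
      next
        case False
        \<comment> \<open>This includes \<open>x = s - 1\<close>, where \<open>x + 1 - s\<close> is
          exactly 0.\<close>
        then have "nat (x - s) = 0" "nat (x + 1 - s) = 0" by simp_all
        then show ?thesis
          using False by (simp add: op_def g_def B.g_0)
      qed
      have g_bd: "\<bar>g x\<bar> \<le> (\<Sum>i\<le>n. \<bar>B.g f i\<bar>)" for x
      proof (cases "nat (x - s) \<le> n")
        case True
        then show ?thesis
          unfolding g_def by (intro member_le_sum[of _ _ "\<lambda>i. \<bar>B.g f i\<bar>"]) auto
      qed (simp add: g_def B.g_eq_0 sum_nonneg)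
      have g_diff: "\<bar>g (x + 1) - g x\<bar> \<le> 1 / \<sigma>2" for x
      proof (cases "0 \<le> x - s")
        case True
        have "\<bar>g (x + 1) - g x\<bar> \<le> 1 / ((real n + 1) * (1/4 - t\<^sup>2))"
          using B.abs_g_diff_le[of f "nat (x - s)"] True unfolding pq
          by (simp add: g_def f_def Suc_nat_eq_nat_zadd1 algebra_simps)
        also have "\<dots> \<le> 1 / \<sigma>2"
          using bounds(7) assms(9) by (intro divide_left_mono) (auto intro: mult_pos_pos)
        finally show ?thesis .
      next
        case False
        then have "nat (x - s) = 0" "nat (x + 1 - s) = 0" by simp_all
        then show ?thesis
          using assms(9) by (simp add: g_def)
      qed
      have stein: "integrable M (\<lambda>\<omega>. op (X \<omega>))"
        "\<bar>expectation (\<lambda>\<omega>. op (X \<omega>))\<bar> \<le> 1 / \<sigma>2 *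
          (\<bar>real n * (1/4 - t\<^sup>2) - \<sigma>2\<bar> + sqrt (variance S) / (2 * lam) + t * sqrt \<sigma>2)"
        using E.stein_operator_bound[where g = g and v = "real n * (1/4 - t\<^sup>2)" and t = t,
          OF assms(11) bounds(3) g_bd g_diff]
        unfolding op_def assms(8) .
      let ?T = "{\<omega> \<in> space M. real n / 2 \<le> \<bar>real_of_int (X \<omega>) - \<mu>\<bar>}"
      have "\<bar>measure ?P A - measure ?Q A - expectation (\<lambda>\<omega>. op (X \<omega>))\<bar>
          = \<bar>expectation (\<lambda>\<omega>. indicator A (X \<omega>) - measure ?Q A - op (X \<omega>))\<bar>"
      proof -
        have "measure ?P A = expectation (\<lambda>\<omega>. indicator A (X \<omega>))"
          by (subst integral_distr[of X M "count_space UNIV" "indicator A :: _ \<Rightarrow> real", symmetric]) auto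
        moreover have "integrable M (\<lambda>\<omega>. indicator A (X \<omega>) :: real)"
          by (rule integrable_const_bound[of _ 1]) (auto simp: indicator_def)
        ultimately show ?thesis
          using stein(1) by (simp add: prob_space)
      qed
      also have "\<dots> \<le> expectation (\<lambda>\<omega>. \<bar>indicator A (X \<omega>) - measure ?Q A - op (X \<omega>)\<bar>)"
        by (rule integral_abs_bound)
      also have "\<dots> \<le> expectation (indicator ?T)"
      \<comment> \<open>On \<open>0 \<le> X - s \<le> n\<close> the Stein equation makes the
        integrand 0; elsewhere \<open>op\<close> is 0, the integrand is at most 1, and
        \<open>X\<close> lies in the Chebyshev tail.\<close>
      proof (rule integral_mono)
        show "integrable M (\<lambda>\<omega>. \<bar>indicator A (X \<omega>) - measure ?Q A - op (X \<omega>)\<bar>)"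
          using stein(1) by (intro integrable_abs Bochner_Integration.integrable_diff
              integrable_const_bound[of "\<lambda>\<omega>. indicator A (X \<omega>)" 1]) (auto simp: indicator_def)
        show "\<bar>indicator A (X \<omega>) - measure ?Q A - op (X \<omega>)\<bar> \<le> indicator ?T \<omega>" if "\<omega> \<in> space M" for \<omega>
        proof (cases "0 \<le> X \<omega> - s \<and> X \<omega> - s \<le> int n")
          case True
          then show ?thesis by (simp add: op)
        next
          case False
          \<comment> \<open>The support begins at distance \<open>n / 2 - n * t\<close> below
            \<open>\<mu>\<close>. Integrality adds 1, which outweighs \<open>n * t < 1\<close>, so
            the distance exceeds \<open>n / 2\<close>.\<close>
          then have "real_of_int (X \<omega>) \<le> real_of_int s - 1 \<or> real_of_int s + real n + 1 \<le> real_of_int (X \<omega>)"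
            by linarith
          then have "real n / 2 \<le> \<bar>real_of_int (X \<omega>) - \<mu>\<bar>"
            using rs bounds(5) mult_nonneg_nonneg[OF of_nat_0_le_iff bounds(3), of n]
            unfolding right_diff_distrib by linarith
          moreover have "\<bar>indicator A (X \<omega>) - measure ?Q A\<bar> \<le> 1"
            using measure_pmf.prob_le_1[of "tsb_pmf \<mu> \<sigma>2" A] by (auto simp: indicator_def)
          ultimately show ?thesis
            using False that by (auto simp: op)
        qed
      qed (simp add: integrable_indicator_iff emeasure_eq_measure)
      also have "\<dots> \<le> 1/4 / \<sigma>2"
        using tail by simp
      finally have "\<bar>measure ?P A - measure ?Q A\<bar> \<le> 1/4 / \<sigma>2 + 1 / \<sigma>2 *
          (\<bar>real n * (1/4 - t\<^sup>2) - \<sigma>2\<bar> + sqrt (variance S) / (2 * lam) + t * sqrt \<sigma>2)"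
        using stein(2) by linarith
      \<comment> \<open>The tail, the variance mismatch and the skewness term each cost 1/4, giving
        3/4 in all, below 1.4.\<close>
      also have "\<dots> \<le> 1/4 / \<sigma>2 + 1 / \<sigma>2 * (1/4 + sqrt (variance S) / (2 * lam) + 1/4)"
        using bounds(6,8) assms(9) by (intro add_left_mono mult_left_mono add_mono) auto
      also have "\<dots> = sqrt (variance S) / (2 * lam * \<sigma>2) + (3/4) / \<sigma>2"
        using assms(9,11) by (simp add: field_simps)
      also have "\<dots> \<le> sqrt (variance S) / (2 * lam * \<sigma>2) + 1.4 / \<sigma>2"
        using assms(9) by (intro add_left_mono divide_right_mono) auto
      finally show "\<bar>measure ?P A - measure ?Q A\<bar>
          \<le> sqrt (variance S) / (2 * lam * \<sigma>2) + 1.4 / \<sigma>2" .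
    qed
  qed
qed

end
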